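(* Let $Q=(U,\Omega,r)$ be a connected tight multimatroid and let $A$ be a non-empty subtransversal of $\Omega$ such that $Q|A$ is connected. If $e\in A$, then either (i) $Q|\{e\}$ is connected; or (ii) for every $x$ such that $\{e,x\}$ is a skew pair, $Q|\{x\}$ is connected and has $Q|A$ as a minor.
   Context: A multimatroid $Q=(U,\Omega,r)$ consists of a finite set $U$, a partition $\Omega$ of $U$ into skew classes (two distinct elements of the same skew class form a skew pair), and a function $r$ from the set $\mathcal S(\Omega)$ of subtransversals (sets meeting each skew class in at most one element) to the non-negative integers satisfying: (1) $r(\emptyset)=0$; (2) $r(A)\le r(A\cup x)\le r(A)+1$ whenever $A\in\mathcal S(\Omega)$ and $x$ lies in a skew class avoiding $A$; (3) $r(A)+r(B)\ge r(A\cup B)+r(A\cap B)$ whenever $A\cup B\in\mathcal S(\Omega)$; (4) $r(A\cup x)-r(A)+r(A\cup y)-r(A)\ge 1$ whenever $A\in\mathcal S(\Omega)$ and $\{x,y\}$ is a skew pair in a skew class avoiding $A$. For $A\in\mathcal S(\Omega)$, the minor $Q|A$ is the multimatroid whose skew classes are those of $Q$ disjoint from $A$, whose ground set is their union, and whose rank function is $X\mapsto r(X\cup A)-r(A)$. A minor of $Q$ is any multimatroid of the form $Q|A$; "$Q'$ has $N$ as a minor" means $N$ is a minor of $Q'$. A separator of $Q$ is a union $X$ of skew classes such that $r(S)=r(S\cap X)+r(S-X)$ for all subtransversals $S$; it is proper if $X\neq\emptyset$ and $X\ne U$; $Q$ is connected if it has no proper separator. $Q$ is non-degenerate if no skew class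 has size 1, and tight if it is non-degenerate and for every skew class $\omega$ and every subtransversal $A$ meeting all skew classes except $\omega$, $\sum_{x\in\omega}(r(A\cup x)-r(A))=|\omega|-1$. *)

theory Defs
  imports Main "HOL-Library.Disjoint_Sets"
begin

record 'a premultimatroid =
  ground :: "'a set"
  skew_classes :: "'a set set"
  rank :: "'a set \<Rightarrow> nat"

definition subtransversals :: "'a premultimatroid \<Rightarrow> 'a set set" where
  "subtransversals Q =
     {A. A \<subseteq> ground Q \<and> (\<forall>\<omega>\<in>skew_classes Q. card (A \<inter> \<omega>) \<le> 1)}"

definition skew_pair :: "'a premultimatroid \<Rightarrow> 'a \<Rightarrow> 'a \<Rightarrow> bool" where
  "skew_pair Q x y \<longleftrightarrow> x \<noteq> y \<and> (\<exists>\<omega>\<in>skew_classes Q. x \<in> \<omega> \<and> y \<in> \<omega>)"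

text \<open>
  The rank function of a multimatroid has domain \<^term>\<open>subtransversals Q\<close>; here it is a total
  function whose values on other sets are irrelevant and never constrained. In particular,
  two records describe the same multimatroid as soon as they satisfy \<open>same_multimatroid\<close> below.
\<close>

locale multimatroid =
  fixes Q :: "'a premultimatroid"
  assumes finite_ground: "finite (ground Q)"
    and partition: "partition_on (ground Q) (skew_classes Q)"
    and rank_empty: "rank Q {} = 0"
    and rank_step: "\<And>A \<omega> x. \<lbrakk>A \<in> subtransversals Q; \<omega> \<in> skew_classes Q; \<omega> \<inter> A = {}; x \<in> \<omega>\<rbrakk>
      \<Longrightarrow> rank Q A \<le> rank Q (A \<union> {x}) \<and> rank Q (A \<union> {x}) \<le> rank Q A + 1"
    and rank_submodular: "\<And>A B. \<lbrakk>A \<in> subtransversals Q; B \<in> subtransversals Q;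
      A \<union> B \<in> subtransversals Q\<rbrakk>
      \<Longrightarrow> rank Q A + rank Q B \<ge> rank Q (A \<union> B) + rank Q (A \<inter> B)"
    and rank_skew_pair: "\<And>A \<omega> x y. \<lbrakk>A \<in> subtransversals Q; \<omega> \<in> skew_classes Q; \<omega> \<inter> A = {};
      x \<in> \<omega>; y \<in> \<omega>; x \<noteq> y\<rbrakk>
      \<Longrightarrow> (int (rank Q (A \<union> {x})) - int (rank Q A))
          + (int (rank Q (A \<union> {y})) - int (rank Q A)) \<ge> 1"

text \<open>
  For a multimatroid \<open>Q\<close>, the rank function is monotone on subtransversals, so the subtraction
  on natural numbers in the next definition does not truncate on subtransversals of the minor.
\<close>

definition mm_minor :: "'a premultimatroid \<Rightarrow> 'a set \<Rightarrow> 'a premultimatroid" where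
  "mm_minor Q A =
     \<lparr> ground = \<Union>{\<omega> \<in> skew_classes Q. \<omega> \<inter> A = {}},
       skew_classes = {\<omega> \<in> skew_classes Q. \<omega> \<inter> A = {}},
       rank = (\<lambda>X. rank Q (X \<union> A) - rank Q A) \<rparr>"

definition same_multimatroid :: "'a premultimatroid \<Rightarrow> 'a premultimatroid \<Rightarrow> bool" where
  "same_multimatroid Q Q' \<longleftrightarrow>
     ground Q = ground Q' \<and> skew_classes Q = skew_classes Q' \<and>
     (\<forall>S\<in>subtransversals Q. rank Q S = rank Q' S)"

definition has_minor :: "'a premultimatroid \<Rightarrow> 'a premultimatroid \<Rightarrow> bool" where
  "has_minor Q N \<longleftrightarrow> (\<exists>B\<in>subtransversals Q. same_multimatroid N (mm_minor Q B))"

definition separator :: "'a premultimatroid \<Rightarrow> 'a set \<Rightarrow> bool" where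
  "separator Q X \<longleftrightarrow>
     (\<exists>F\<subseteq>skew_classes Q. X = \<Union>F) \<and>
     (\<forall>S\<in>subtransversals Q. rank Q S = rank Q (S \<inter> X) + rank Q (S - X))"

definition proper_separator :: "'a premultimatroid \<Rightarrow> 'a set \<Rightarrow> bool" where
  "proper_separator Q X \<longleftrightarrow> separator Q X \<and> X \<noteq> {} \<and> X \<noteq> ground Q"

definition mm_connected :: "'a premultimatroid \<Rightarrow> bool" where
  "mm_connected Q \<longleftrightarrow> \<not> (\<exists>X. proper_separator Q X)"

definition nondegenerate :: "'a premultimatroid \<Rightarrow> bool" where
  "nondegenerate Q \<longleftrightarrow> (\<forall>\<omega>\<in>skew_classes Q. card \<omega> \<noteq> 1)"

definition tight :: "'a premultimatroid \<Rightarrow> bool" where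
  "tight Q \<longleftrightarrow> nondegenerate Q \<and>
     (\<forall>\<omega>\<in>skew_classes Q. \<forall>A\<in>subtransversals Q.
        \<omega> \<inter> A = {} \<and> (\<forall>\<omega>'\<in>skew_classes Q. \<omega>' \<noteq> \<omega> \<longrightarrow> \<omega>' \<inter> A \<noteq> {}) \<longrightarrow>
        (\<Sum>x\<in>\<omega>. int (rank Q (A \<union> {x})) - int (rank Q A)) = int (card \<omega>) - 1)"

end

theory Submission
  imports Defs
begin

text \<open>
  Suppose that \<open>X\<close> is a proper separator of \<open>Q|e\<close> with complement \<open>Y\<close>, and let \<open>\<omega>\<close> be the skew
  class of \<open>e\<close>. A subtransversal avoiding \<open>\<omega>\<close> spans at most one element of \<open>\<omega>\<close>. If no
  subtransversal inside \<open>X\<close> spanned \<open>e\<close>, tightness would make \<open>X\<close> a separator of \<open>Q\<close>; hence both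
  \<open>X\<close> and \<open>Y\<close> contain subtransversals spanning \<open>e\<close>. If \<open>Z \<subseteq> Y\<close> spans \<open>e\<close> and \<open>x \<noteq> e\<close> lies in \<open>\<omega>\<close>,
  then no superset of \<open>Z\<close> spans \<open>x\<close>, so \<open>r(W \<union> Z \<union> x) = r(W \<union> e) + r(Z)\<close> for \<open>W \<subseteq> X\<close>: on \<open>X\<close>, contracting
  \<open>Z \<union> x\<close> has the same effect as contracting \<open>e\<close>. Since \<open>Q|A\<close> is connected it lives on one side,
  say \<open>X\<close>, and so \<open>Q|A = Q|((A \<inter> X) \<union> Z \<union> x)\<close> for a transversal \<open>Z\<close> of \<open>Y\<close> spanning \<open>e\<close>. The same
  identity shows that a proper separator of \<open>Q|x\<close> is also one of \<open>Q|e\<close>; then one side of it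
  spans \<open>e\<close> and the other \<open>x\<close>, which is impossible.
\<close>

text \<open>The case of interest is a \<open>z\<close> whose skew class avoids \<open>S\<close>;
  there it says that \<open>z\<close> has rank 0 in \<open>Q|S\<close>. For \<open>z\<close> in
  \<open>S\<close> it holds trivially.\<close>

definition spans :: "'a premultimatroid \<Rightarrow> 'a set \<Rightarrow> 'a \<Rightarrow> bool" where
  "spans Q S z \<longleftrightarrow> rank Q (insert z S) = rank Q S"

text \<open>Adding the elements of \<open>D\<close> one by one, \<open>P\<close> must become true at
  some element \<open>a\<close>; \<open>E\<close> is the set just before.\<close>

lemma finite_first_step:
  assumes "finite D" "\<not> P {}" "P D"
  shows "\<exists>E a. insert a E \<subseteq> D \<and> a \<notin> E \<and> \<not> P E \<and> P (insert a E)"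
  using assms
proof (induction D)
  case empty
  then show ?case by blast
next
  case (insert d D)
  then show ?case by (cases "P D") blast+
qed

context multimatroid
begin

section \<open>Skew classes and subtransversals\<close>

lemma class_subset: "\<omega> \<in> skew_classes Q \<Longrightarrow> \<omega> \<subseteq> ground Q"
  using partition unfolding partition_on_def by blast

lemma class_nonempty: "\<omega> \<in> skew_classes Q \<Longrightarrow> \<omega> \<noteq> {}"
  using partition unfolding partition_on_def by blast

lemma class_unique:
  "\<lbrakk>\<omega> \<in> skew_classes Q; \<omega>' \<in> skew_classes Q; x \<in> \<omega>; x \<in> \<omega>'\<rbrakk> \<Longrightarrow> \<omega> = \<omega>'"
  using partition unfolding partition_on_def disjoint_def by blast

lemma class_inter_Union:
  "\<lbrakk>\<omega> \<in> skew_classes Q; G \<subseteq> skew_classes Q; \<omega> \<notin> G\<rbrakk> \<Longrightarrow> \<omega> \<inter> \<Union>G = {}"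
  using class_unique by blast

lemma ground_class: "x \<in> ground Q \<Longrightarrow> \<exists>\<omega>\<in>skew_classes Q. x \<in> \<omega>"
  using partition unfolding partition_on_def by blast

lemma finite_classes: "finite (skew_classes Q)"
  using finite_ground partition by (metis finite_UnionD partition_on_def)

lemma class_finite: "\<omega> \<in> skew_classes Q \<Longrightarrow> finite \<omega>"
  using class_subset finite_ground finite_subset by blast

text \<open>Trades cardinalities for an elementwise condition. Finiteness of the classes matters,
  since \<open>card\<close> is 0 on infinite sets.\<close>

lemma subtransversal_iff:
  "A \<in> subtransversals Q \<longleftrightarrow> A \<subseteq> ground Q \<and>
     (\<forall>\<omega>\<in>skew_classes Q. \<forall>x\<in>A \<inter> \<omega>. \<forall>y\<in>A \<inter> \<omega>. x = y)"
proof -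
  have "card (A \<inter> \<omega>) \<le> 1 \<longleftrightarrow> (\<forall>x\<in>A \<inter> \<omega>. \<forall>y\<in>A \<inter> \<omega>. x = y)" if "\<omega> \<in> skew_classes Q" for \<omega>
    using class_finite[OF that] by (simp only: One_nat_def card_le_Suc0_iff_eq finite_Int simp_thms)
  then show ?thesis unfolding subtransversals_def by blast
qed

lemma subtransversal_ground: "A \<in> subtransversals Q \<Longrightarrow> A \<subseteq> ground Q"
  unfolding subtransversals_def by blast

lemma subtransversal_eq:
  "\<lbrakk>A \<in> subtransversals Q; \<omega> \<in> skew_classes Q; x \<in> A; x \<in> \<omega>; y \<in> A; y \<in> \<omega>\<rbrakk> \<Longrightarrow> x = y"
  unfolding subtransversal_iff by blast

lemma subtransversal_subset:
  "\<lbrakk>A \<in> subtransversals Q; B \<subseteq> A\<rbrakk> \<Longrightarrow> B \<in> subtransversals Q"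
  unfolding subtransversal_iff by blast

lemma subtransversal_finite: "A \<in> subtransversals Q \<Longrightarrow> finite A"
  unfolding subtransversal_iff using finite_ground finite_subset by blast

lemma subtransversal_insert:
  assumes "A \<in> subtransversals Q" "\<omega> \<in> skew_classes Q" "x \<in> \<omega>" "\<omega> \<inter> A = {}"
  shows "insert x A \<in> subtransversals Q"
  unfolding subtransversal_iff
proof (intro conjI ballI)
  show "insert x A \<subseteq> ground Q"
    using assms(3) class_subset[OF assms(2)] subtransversal_ground[OF assms(1)] by blast
next
  fix \<omega>' u v
  assume w: "\<omega>' \<in> skew_classes Q" and u: "u \<in> insert x A \<inter> \<omega>'" and v: "v \<in> insert x A \<inter> \<omega>'"
  show "u = v"
  proof (cases "\<omega>' = \<omega>")
    case True
    then show ?thesis using u v assms(4) by blast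
  next
    case False
    then have "x \<notin> \<omega>'" using class_unique[OF w assms(2) _ assms(3)] by blast
    then show ?thesis using u v subtransversal_eq[OF assms(1) w] by blast
  qed
qed

lemma subtransversal_singleton:
  "\<lbrakk>\<omega> \<in> skew_classes Q; x \<in> \<omega>\<rbrakk> \<Longrightarrow> {x} \<in> subtransversals Q"
  using subtransversal_insert[of "{}" \<omega> x] unfolding subtransversal_iff by simp

lemma subtransversal_Un:
  assumes "A \<in> subtransversals Q" "B \<in> subtransversals Q"
    and "\<And>\<omega>. \<lbrakk>\<omega> \<in> skew_classes Q; \<omega> \<inter> A \<noteq> {}\<rbrakk> \<Longrightarrow> \<omega> \<inter> B = {}"
  shows "A \<union> B \<in> subtransversals Q"
  unfolding subtransversal_iff
proof (intro conjI ballI)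
  show "A \<union> B \<subseteq> ground Q" using assms subtransversal_ground by blast
next
  fix \<omega> x y
  assume w: "\<omega> \<in> skew_classes Q" and x: "x \<in> (A \<union> B) \<inter> \<omega>" and y: "y \<in> (A \<union> B) \<inter> \<omega>"
  show "x = y"
    using x y assms(3)[OF w] subtransversal_eq[OF assms(1) w, of x y]
      subtransversal_eq[OF assms(2) w, of x y] by blast
qed

text \<open>Glues subtransversals from the two sides of a separator: no class can meet both, because
  a class lies either in \<open>F\<close> or outside \<open>\<Union>F\<close>.\<close>

lemma subtransversal_Un_separated:
  assumes "F \<subseteq> skew_classes Q" "A \<in> subtransversals Q" "A \<subseteq> \<Union>F"
    and "B \<in> subtransversals Q" "B \<inter> \<Union>F = {}"
  shows "A \<union> B \<in> subtransversals Q"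
proof (rule subtransversal_Un[OF assms(2,4)])
  fix \<omega> assume w: "\<omega> \<in> skew_classes Q" "\<omega> \<inter> A \<noteq> {}"
  then have "\<omega> \<in> F" using class_inter_Union[OF w(1) assms(1)] assms(3) by blast
  then show "\<omega> \<inter> B = {}" using assms(5) by blast
qed

lemma class_inter_insert_eq:
  assumes "insert x S \<in> subtransversals Q" "\<omega> \<in> skew_classes Q" "x \<in> \<omega>" "x \<notin> S"
  shows "\<omega> \<inter> S = {}"
  using subtransversal_eq[OF assms(1,2), of x] assms(3,4) by blast

section \<open>Rank increments and spanned elements\<close>

lemma rank_insert:
  assumes "A \<in> subtransversals Q" "\<omega> \<in> skew_classes Q" "x \<in> \<omega>" "\<omega> \<inter> A = {}"
  shows "rank Q A \<le> rank Q (insert x A)" "rank Q (insert x A) \<le> rank Q A + 1"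
  using rank_step[of A \<omega> x] assms by auto

lemma rank_insert_skew:
  assumes "A \<in> subtransversals Q" "\<omega> \<in> skew_classes Q" "\<omega> \<inter> A = {}" "x \<in> \<omega>" "y \<in> \<omega>" "x \<noteq> y"
  shows "rank Q (insert x A) + rank Q (insert y A) \<ge> 2 * rank Q A + 1"
  using rank_skew_pair[of A \<omega> x y] assms by simp

text \<open>By the skew pair axiom, two distinct elements of a class avoiding \<open>A\<close>
  cannot both have increment 0.\<close>

lemma spans_unique:
  assumes "A \<in> subtransversals Q" "\<omega> \<in> skew_classes Q" "\<omega> \<inter> A = {}" "x \<in> \<omega>" "y \<in> \<omega>"
    and "spans Q A x" "spans Q A y"
  shows "x = y"
  using rank_insert_skew[OF assms(1-5)] assms(6,7) unfolding spans_def by fastforce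

lemma rank_not_spans:
  assumes "A \<in> subtransversals Q" "\<omega> \<in> skew_classes Q" "x \<in> \<omega>" "\<omega> \<inter> A = {}" "\<not> spans Q A x"
  shows "rank Q (insert x A) = rank Q A + 1"
  using rank_insert[OF assms(1-4)] assms(5) unfolding spans_def by linarith

text \<open>Submodularity for \<open>T\<close> and \<open>insert z S\<close>, whose intersection is
  \<open>S\<close>: the increment of \<open>z\<close> cannot grow from \<open>S\<close> to
  \<open>T\<close>.\<close>

lemma spans_mono:
  assumes "spans Q S z" "S \<subseteq> T" "T \<in> subtransversals Q"
    and "\<omega> \<in> skew_classes Q" "z \<in> \<omega>" "\<omega> \<inter> T = {}"
  shows "spans Q T z"
proof -
  have zT: "insert z T \<in> subtransversals Q" using subtransversal_insert assms by blast
  then have zS: "insert z S \<in> subtransversals Q" 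
    using subtransversal_subset assms(2) by (meson insert_mono)
  have *: "T \<inter> insert z S = S" "T \<union> insert z S = insert z T" using assms by auto
  have "rank Q T + rank Q (insert z S) \<ge> rank Q (insert z T) + rank Q S"
    using rank_submodular[OF assms(3) zS] zT unfolding * by simp
  moreover have "rank Q T \<le> rank Q (insert z T)" using rank_insert assms by blast
  ultimately show ?thesis using assms(1) unfolding spans_def by linarith
qed

text \<open>If \<open>z\<close> raised the rank of \<open>S\<close>, the skew pair axiom over
  \<open>S \<union> z\<close> would make the ranks of \<open>S \<union> z \<union> a\<close> and
  \<open>S \<union> z \<union> b\<close> sum to at least \<open>2 r(S) + 3\<close>. Since
  \<open>z\<close> is spanned, these are the ranks of \<open>S \<union> a\<close> and
  \<open>S \<union> b\<close>, whose sum is at most \<open>2 r(S) + 2\<close>.\<close>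

lemma spans_skew:
  assumes S: "S \<in> subtransversals Q"
    and w: "\<omega> \<in> skew_classes Q" "z \<in> \<omega>" "\<omega> \<inter> S = {}"
    and w': "\<omega>' \<in> skew_classes Q" "\<omega>' \<inter> S = {}" "\<omega>' \<noteq> \<omega>" "a \<in> \<omega>'" "b \<in> \<omega>'" "a \<noteq> b"
    and sp: "spans Q (insert a S) z" "spans Q (insert b S) z"
  shows "spans Q S z"
proof (rule ccontr)
  assume "\<not> spans Q S z"
  then have 1: "rank Q (insert z S) = rank Q S + 1" using rank_not_spans S w by blast
  have zS: "insert z S \<in> subtransversals Q" using subtransversal_insert S w by blast
  have "z \<notin> \<omega>'" using class_unique w w' by blast
  then have "\<omega>' \<inter> insert z S = {}" using w' by blast
  then have "rank Q (insert a (insert z S)) + rank Q (insert b (insert z S)) \<ge> 2 * rank Q (insert z S) + 1"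
    using rank_insert_skew zS w' by blast
  moreover have "rank Q (insert a S) \<le> rank Q S + 1" "rank Q (insert b S) \<le> rank Q S + 1"
    using rank_insert S w' by blast+
  ultimately show False using sp 1 unfolding spans_def by (simp add: insert_commute)
qed

section \<open>Growing a subtransversal class by class\<close>

text \<open>Greedy extension that keeps \<open>P\<close> true. The induction runs over the classes
  already met, while the bound \<open>T \<union> \<Union>G\<close> stays fixed so that
  \<open>step\<close> remains applicable.\<close>

lemma extend_invariant:
  assumes "T \<in> subtransversals Q" "P T" "G \<subseteq> skew_classes Q"
    and step: "\<And>S g. \<lbrakk>S \<in> subtransversals Q; T \<subseteq> S; S \<subseteq> T \<union> \<Union>G; P S; g \<in> G; g \<inter> S = {}\<rbrakk>
      \<Longrightarrow> \<exists>a\<in>g. P (insert a S)"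
  obtains T' where "T' \<in> subtransversals Q" "T \<subseteq> T'" "T' \<subseteq> T \<union> \<Union>G" "P T'"
    "\<forall>g\<in>G. g \<inter> T' \<noteq> {}"
proof -
  have fin: "finite G" using assms(3) finite_classes finite_subset by blast
  have "H \<subseteq> G \<Longrightarrow> \<exists>T'\<in>subtransversals Q. T \<subseteq> T' \<and> T' \<subseteq> T \<union> \<Union>G \<and> P T' \<and> (\<forall>g\<in>H. g \<inter> T' \<noteq> {})"
    if "finite H" for H
    using that
  proof (induction H)
    case empty
    then show ?case using assms(1,2) by blast
  next
    case (insert h H)
    then obtain T' where T': "T' \<in> subtransversals Q" "T \<subseteq> T'" "T' \<subseteq> T \<union> \<Union>G" "P T'"
      "\<forall>g\<in>H. g \<inter> T' \<noteq> {}" by blast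
    show ?case
    proof (cases "h \<inter> T' = {}")
      case True
      then obtain a where a: "a \<in> h" "P (insert a T')" using step T' insert.prems by blast
      have "insert a T' \<in> subtransversals Q"
        using subtransversal_insert[OF T'(1) _ a(1) True] insert.prems assms(3) by blast
      then show ?thesis using a T' insert.prems by (intro bexI[of _ "insert a T'"]) auto
    next
      case False
      then show ?thesis using T' by blast
    qed
  qed
  then show ?thesis using fin that by blast
qed

lemma extend_spanning:
  assumes "T \<in> subtransversals Q" "G \<subseteq> skew_classes Q" "spans Q T z"
    and "\<omega> \<in> skew_classes Q" "z \<in> \<omega>" "\<omega> \<inter> T = {}" "\<omega> \<notin> G"
  obtains T' where "T' \<in> subtransversals Q" "T \<subseteq> T'" "T' \<subseteq> T \<union> \<Union>G" "spans Q T' z"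
    "\<forall>g\<in>G. g \<inter> T' \<noteq> {}"
proof -
  obtain T' where T': "T' \<in> subtransversals Q" "T \<subseteq> T'" "T' \<subseteq> T \<union> \<Union>G" "\<forall>g\<in>G. g \<inter> T' \<noteq> {}"
  proof (rule extend_invariant[of T "\<lambda>_. True" G])
    show "\<exists>a\<in>g. True" if "g \<in> G" for g using class_nonempty that assms(2) by blast
  qed (use assms that in auto)
  have "\<omega> \<inter> T' = {}" using T'(3) assms(6) class_inter_Union[OF assms(4,2,7)] by blast
  then show ?thesis using that[OF T'(1-3) _ T'(4)] spans_mono[OF assms(3) T'(2,1) assms(4,5)] by blast
qed

text \<open>Non-degeneracy puts a skew pair into every class of \<open>G\<close>, and by
  \<open>spans_skew\<close> at least one of its two elements can be added without spanning
  \<open>z\<close>.\<close>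

lemma extend_not_spanning:
  assumes "T \<in> subtransversals Q" "G \<subseteq> skew_classes Q" "\<not> spans Q T z"
    and w: "\<omega> \<in> skew_classes Q" "z \<in> \<omega>" "\<omega> \<inter> T = {}" "\<omega> \<notin> G"
    and nd: "nondegenerate Q"
  obtains T' where "T' \<in> subtransversals Q" "T \<subseteq> T'" "T' \<subseteq> T \<union> \<Union>G" "\<not> spans Q T' z"
    "\<forall>g\<in>G. g \<inter> T' \<noteq> {}"
proof -
  have "\<exists>a\<in>g. \<not> spans Q (insert a S) z"
    if S: "S \<in> subtransversals Q" "S \<subseteq> T \<union> \<Union>G" "\<not> spans Q S z" "g \<in> G" "g \<inter> S = {}" for S g
  proof -
    have g: "g \<in> skew_classes Q" "g \<noteq> \<omega>" using S assms by blast+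
    have "card g \<noteq> 0" "card g \<noteq> 1"
      using g class_finite class_nonempty nd unfolding nondegenerate_def by auto
    then obtain a b where ab: "a \<in> g" "b \<in> g" "a \<noteq> b"
      using card_le_Suc0_iff_eq[OF class_finite[OF g(1)]] by force
    have "\<omega> \<inter> S = {}" using S(2) w(3) class_inter_Union[OF w(1) assms(2) w(4)] by blast
    then show ?thesis using spans_skew[OF S(1) w(1,2)] g S ab by blast
  qed
  note step = this
  show ?thesis
  proof (rule extend_invariant[where P = "\<lambda>S. \<not> spans Q S z", OF assms(1,3,2)], goal_cases)
    case (1 S g)
    then show ?case using step by blast
  next
    case (2 T')
    then show ?case by (rule that)
  qed
qed

section \<open>Consequences of tightness and connectedness\<close>

text \<open>If no element of \<open>\<omega>\<close> were spanned, all increments would be 1 and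
  would sum to \<open>card \<omega>\<close> instead of \<open>card \<omega> - 1\<close>.\<close>

lemma tight_spans:
  assumes "tight Q" "A \<in> subtransversals Q" "\<omega> \<in> skew_classes Q" "\<omega> \<inter> A = {}"
    and "\<And>\<omega>'. \<lbrakk>\<omega>' \<in> skew_classes Q; \<omega>' \<noteq> \<omega>\<rbrakk> \<Longrightarrow> \<omega>' \<inter> A \<noteq> {}"
  obtains x where "x \<in> \<omega>" "spans Q A x"
proof -
  have "(\<Sum>x\<in>\<omega>. int (rank Q (A \<union> {x})) - int (rank Q A)) = int (card \<omega>) - 1"
    using assms unfolding tight_def by blast
  moreover have "(\<Sum>x\<in>\<omega>. int (rank Q (A \<union> {x})) - int (rank Q A)) = (\<Sum>x\<in>\<omega>. 1)"
    if "\<forall>x\<in>\<omega>. \<not> spans Q A x"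
    using that rank_not_spans[OF assms(2,3) _ assms(4)] by (intro sum.cong) auto
  ultimately show ?thesis using that by fastforce
qed

text \<open>Here \<open>T\<close> misses exactly the classes \<open>\<omega>\<close> and
  \<open>\<omega>'\<close>, and tightness is applied in both directions: at \<open>\<omega>'\<close>
  over \<open>T \<union> e\<close> and at \<open>\<omega>\<close> over
  \<open>T \<union> c\<close>.\<close>

lemma tight_exchange:
  assumes tight: "tight Q" and T: "T \<in> subtransversals Q"
    and w: "\<omega> \<in> skew_classes Q" "\<omega> \<inter> T = {}" "z \<in> \<omega>" "e \<in> \<omega>"
    and w': "\<omega>' \<in> skew_classes Q" "\<omega>' \<inter> T = {}" "a \<in> \<omega>'" "\<omega>' \<noteq> \<omega>"
    and meets: "\<And>\<phi>. \<lbrakk>\<phi> \<in> skew_classes Q; \<phi> \<noteq> \<omega>; \<phi> \<noteq> \<omega>'\<rbrakk> \<Longrightarrow> \<phi> \<inter> T \<noteq> {}"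
    and sp: "spans Q (insert a T) z" "\<not> spans Q T z"
  obtains c where "c \<in> \<omega>'" "spans Q (insert c T) e"
proof -
  have disj: "\<omega> \<inter> \<omega>' = {}" using class_unique w w' by blast
  have insT: "insert c T \<in> subtransversals Q" "\<omega> \<inter> insert c T = {}" if "c \<in> \<omega>'" for c
    using subtransversal_insert[OF T w'(1) that w'(2)] w that disj by blast+
  \<comment> \<open>\<open>T \<union> a\<close> spans \<open>z\<close> and also every
    \<open>u\<close> spanned by \<open>T\<close>, so such a \<open>u\<close> is \<open>z\<close>. As
    \<open>T\<close> does not span \<open>z\<close>, it spans nothing in
    \<open>\<omega>\<close>.\<close>
  have only_z: "u = z" if "u \<in> \<omega>" "spans Q T u" for u
    using spans_mono[OF that(2) _ insT(1) w(1) that(1) insT(2)] spans_unique[OF insT(1) w(1) insT(2)]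
      that(1) w(3) sp(1) w'(3) by blast
  then have e: "rank Q (insert e T) = rank Q T + 1"
    using rank_not_spans[OF T w(1,4,2)] sp(2) w(4) by blast
  have eT: "insert e T \<in> subtransversals Q" "\<omega>' \<inter> insert e T = {}"
    using subtransversal_insert[OF T w(1,4,2)] w w' disj by blast+
  obtain c where c: "c \<in> \<omega>'" "spans Q (insert e T) c"
    using tight_spans[OF tight eT(1) w'(1) eT(2)] meets w(4) by blast
  obtain u where u: "u \<in> \<omega>" "spans Q (insert c T) u"
    using tight_spans[OF tight insT(1)[OF c(1)] w(1) insT(2)[OF c(1)]] meets c(1) by blast
  \<comment> \<open>If \<open>T\<close> spanned \<open>c\<close>, the element \<open>u\<close> of
    \<open>\<omega>\<close> spanned by \<open>T \<union> c\<close> would already be spanned by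
    \<open>T\<close>. With this equality, \<open>T \<union> c\<close>, \<open>T \<union> e\<close>
    and \<open>T \<union> {c, e}\<close> all have the same rank.\<close>
  have "rank Q (insert c T) = rank Q T + 1"
  proof (rule ccontr)
    assume "rank Q (insert c T) \<noteq> rank Q T + 1"
    then have *: "rank Q (insert c T) = rank Q T" 
      using rank_insert[OF T w'(1) c(1) w'(2)] by linarith
    have uT: "insert u T \<in> subtransversals Q" "\<omega>' \<inter> insert u T = {}"
      using subtransversal_insert[OF T w(1) u(1) w(2)] w' u(1) disj by blast+
    have "rank Q (insert u T) \<le> rank Q (insert c (insert u T))"
      using rank_insert[OF uT(1) w'(1) c(1) uT(2)] by blast
    then have "rank Q (insert u T) \<le> rank Q T"
      using u(2) * unfolding spans_def by (simp add: insert_commute)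
    then have "spans Q T u" using rank_insert[OF T w(1) u(1) w(2)] unfolding spans_def by linarith
    then show False using only_z u(1) sp(2) by blast
  qed
  then have "spans Q (insert c T) e" using c(2) e unfolding spans_def by (simp add: insert_commute)
  then show ?thesis using that c by blast
qed

text \<open>An element \<open>z\<close> of rank 0 would make \<open>\<omega>\<close> a separator:
  \<open>z\<close> never adds rank outside \<open>\<omega>\<close>, and every other element of
  \<open>\<omega>\<close> always adds exactly 1, because \<open>z\<close> is the one spanned element
  of the class.\<close>

lemma connected_rank_singleton:
  assumes "mm_connected Q" "\<omega> \<in> skew_classes Q" "\<omega> \<noteq> ground Q" "z \<in> \<omega>"
  shows "rank Q {z} = 1"
proof (rule ccontr)
  have e: "{} \<in> subtransversals Q" unfolding subtransversal_iff by simp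
  assume "rank Q {z} \<noteq> 1"
  then have z: "spans Q {} z"
    using rank_not_spans[OF e assms(2,4)] rank_empty unfolding spans_def by auto
  have "rank Q S = rank Q (S \<inter> \<omega>) + rank Q (S - \<omega>)" if S: "S \<in> subtransversals Q" for S
  proof (cases "S \<inter> \<omega> = {}")
    case True
    then show ?thesis by (simp add: rank_empty Diff_triv)
  next
    case False
    then obtain y where y: "y \<in> S" "y \<in> \<omega>" by blast
    have Sw: "S \<inter> \<omega> = {y}" using S y assms(2) unfolding subtransversal_iff by blast
    have ins: "insert y (S - \<omega>) = S" using Sw by blast
    have S': "S - \<omega> \<in> subtransversals Q" "\<omega> \<inter> (S - \<omega>) = {}"
      using subtransversal_subset[OF S] by blast+
    have spS: "spans Q (S - \<omega>) z" using spans_mono[OF z _ S'(1) assms(2,4) S'(2)] by blast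
    show ?thesis
    proof (cases "y = z")
      case True
      then show ?thesis using Sw ins z spS rank_empty unfolding spans_def by simp
    next
      case False
      then have "\<not> spans Q (S - \<omega>) y" "\<not> spans Q {} y"
        using spans_unique[OF S'(1) assms(2) S'(2) y(2) assms(4)]
          spans_unique[OF e assms(2) _ y(2) assms(4)] spS z by blast+
      then show ?thesis
        using Sw ins rank_not_spans[OF S'(1) assms(2) y(2) S'(2)] rank_not_spans[OF e assms(2) y(2)]
          rank_empty by simp
    qed
  qed
  then have "separator Q \<omega>" unfolding separator_def using assms(2) by (metis ccpo_Sup_singleton empty_subsetI insert_subset)
  then show False
    using assms class_nonempty unfolding mm_connected_def proper_separator_def by blast
qed

section \<open>Monotonicity of the rank; minors and their separators\<close>

lemma rank_mono:
  assumes "T \<in> subtransversals Q" "S \<subseteq> T"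
  shows "rank Q S \<le> rank Q T"
proof -
  have fin: "finite (T - S)" using subtransversal_finite assms by blast
  have "S \<union> D \<subseteq> T \<Longrightarrow> D \<inter> S = {} \<Longrightarrow> rank Q S \<le> rank Q (S \<union> D)" if "finite D" for D
    using that
  proof (induction D)
    case empty
    then show ?case by simp
  next
    case (insert d D)
    have st: "insert d (S \<union> D) \<in> subtransversals Q" "S \<union> D \<in> subtransversals Q"
      using subtransversal_subset[OF assms(1)] insert.prems by auto
    obtain \<omega> where w: "\<omega> \<in> skew_classes Q" "d \<in> \<omega>"
      using ground_class[of d] subtransversal_ground[OF st(1)] by blast
    \<comment> \<open>The rank axiom compares only when the class of the new element is avoided;
      this holds because all sets stay inside the subtransversal \<open>T\<close>.\<close>
    have "\<omega> \<inter> (S \<union> D) = {}" using class_inter_insert_eq[OF st(1) w] insert by blast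
    then have "rank Q (S \<union> D) \<le> rank Q (insert d (S \<union> D))" using rank_insert st w by blast
    then show ?case using insert by simp
  qed
  moreover have "S \<union> (T - S) = T" "(T - S) \<inter> S = {}" using assms by blast+
  ultimately show ?thesis using fin by (metis order_refl)
qed

lemma minor_singleton_classes:
  assumes "\<omega> \<in> skew_classes Q" "x \<in> \<omega>"
  shows "skew_classes (mm_minor Q {x}) = skew_classes Q - {\<omega>}"
  unfolding mm_minor_def using class_unique assms by auto

lemma minor_ground: "ground (mm_minor Q A) = \<Union>(skew_classes (mm_minor Q A))"
  unfolding mm_minor_def by simp

lemma minor_singleton_ground:
  assumes "\<omega> \<in> skew_classes Q" "x \<in> \<omega>"
  shows "ground (mm_minor Q {x}) = ground Q - \<omega>"
  unfolding minor_ground minor_singleton_classes[OF assms]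
  using class_unique assms class_subset ground_class by fastforce

text \<open>A class avoiding \<open>A\<close> meets \<open>S \<union> A\<close> only in
  \<open>S\<close>, and a class meeting \<open>A\<close> meets it only in \<open>A\<close>, so the
  cardinality bounds can be checked separately.\<close>

lemma minor_subtransversal_iff:
  assumes "A \<in> subtransversals Q"
  shows "S \<in> subtransversals (mm_minor Q A) \<longleftrightarrow>
     S \<union> A \<in> subtransversals Q \<and> S \<subseteq> ground (mm_minor Q A)"
proof -
  define C where "C = {\<omega> \<in> skew_classes Q. \<omega> \<inter> A = {}}"
  have g: "ground (mm_minor Q A) = \<Union>C" and c: "skew_classes (mm_minor Q A) = C"
    unfolding C_def mm_minor_def by simp_all
  have "(\<forall>\<omega>\<in>C. card (S \<inter> \<omega>) \<le> 1) \<longleftrightarrow> S \<union> A \<in> subtransversals Q" if S: "S \<subseteq> \<Union>C"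
  proof -
    have 1: "(S \<union> A) \<inter> \<omega> = S \<inter> \<omega>" if "\<omega> \<in> C" for \<omega>
      using that unfolding C_def by blast
    have 2: "(S \<union> A) \<inter> \<omega> = A \<inter> \<omega>" if "\<omega> \<in> skew_classes Q" "\<omega> \<notin> C" for \<omega>
      using that S class_unique unfolding C_def by fastforce
    have SA: "S \<union> A \<subseteq> ground Q"
      using S class_subset assms unfolding C_def subtransversals_def by fastforce
    have A: "card (A \<inter> \<omega>) \<le> 1" if "\<omega> \<in> skew_classes Q" for \<omega>
      using assms that unfolding subtransversals_def by blast
    show ?thesis
    proof (intro iffI ballI)
      assume h: "\<forall>\<omega>\<in>C. card (S \<inter> \<omega>) \<le> 1"
      have "card ((S \<union> A) \<inter> \<omega>) \<le> 1" if "\<omega> \<in> skew_classes Q" for \<omega>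
        using h 1[of \<omega>] 2[OF that] A[OF that] by (cases "\<omega> \<in> C") auto
      then show "S \<union> A \<in> subtransversals Q" using SA unfolding subtransversals_def by blast
    next
      fix \<omega> assume "S \<union> A \<in> subtransversals Q" "\<omega> \<in> C"
      then show "card (S \<inter> \<omega>) \<le> 1"
        using 1[of \<omega>] unfolding subtransversals_def C_def by auto
    qed
  qed
  then show ?thesis using g c unfolding subtransversals_def by auto
qed

lemma minor_singleton_subtransversal_iff:
  assumes "\<omega> \<in> skew_classes Q" "x \<in> \<omega>"
  shows "S \<in> subtransversals (mm_minor Q {x}) \<longleftrightarrow> S \<in> subtransversals Q \<and> \<omega> \<inter> S = {}"
proof -
  have x: "{x} \<in> subtransversals Q" using subtransversal_singleton assms by blast
  show ?thesis
    unfolding minor_subtransversal_iff[OF x] minor_singleton_ground[OF assms]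
  proof (intro iffI conjI)
    assume "S \<union> {x} \<in> subtransversals Q \<and> S \<subseteq> ground Q - \<omega>"
    then show "S \<in> subtransversals Q" "\<omega> \<inter> S = {}" using subtransversal_subset by blast+
  next
    assume S: "S \<in> subtransversals Q \<and> \<omega> \<inter> S = {}"
    then show "S \<union> {x} \<in> subtransversals Q" using subtransversal_insert[of S \<omega> x] assms by simp
    show "S \<subseteq> ground Q - \<omega>" using S subtransversal_ground by blast
  qed
qed

text \<open>The separator identity of \<open>Q|x\<close> with the natural-number subtractions
  cleared: each of its three terms subtracts \<open>r(x)\<close>, and monotonicity of the rank rules
  out truncation.\<close>

lemma separator_minor_iff:
  assumes w: "\<omega> \<in> skew_classes Q" "x \<in> \<omega>"
  shows "separator (mm_minor Q {x}) X \<longleftrightarrow> (\<exists>F\<subseteq>skew_classes Q - {\<omega>}. X = \<Union>F) \<and>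
     (\<forall>S\<in>subtransversals Q. \<omega> \<inter> S = {} \<longrightarrow>
        rank Q (insert x S) + rank Q {x} = rank Q (insert x (S \<inter> X)) + rank Q (insert x (S - X)))"
proof -
  have "(rank (mm_minor Q {x}) S = rank (mm_minor Q {x}) (S \<inter> X) + rank (mm_minor Q {x}) (S - X))
     \<longleftrightarrow> (rank Q (insert x S) + rank Q {x} = rank Q (insert x (S \<inter> X)) + rank Q (insert x (S - X)))"
    if S: "S \<in> subtransversals Q" "\<omega> \<inter> S = {}" for S
  proof -
    have st: "insert x S \<in> subtransversals Q" using subtransversal_insert S w by blast
    have "rank Q {x} \<le> rank Q (insert x S)" "rank Q {x} \<le> rank Q (insert x (S \<inter> X))"
      "rank Q {x} \<le> rank Q (insert x (S - X))"
      by (rule rank_mono[OF subtransversal_subset[OF st]]; blast)+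
    then show ?thesis unfolding mm_minor_def by simp linarith
  qed
  then show ?thesis
    unfolding separator_def minor_singleton_classes[OF w]
    by (auto simp: minor_singleton_subtransversal_iff[OF w])
qed

lemma minor_separator_classes:
  assumes "\<omega> \<in> skew_classes Q" "x \<in> \<omega>" "separator (mm_minor Q {x}) X"
  obtains F where "F \<subseteq> skew_classes Q - {\<omega>}" "X = \<Union>F"
  using assms(3) that unfolding separator_minor_iff[OF assms(1,2)] by metis

lemma minor_separator_rank:
  assumes "\<omega> \<in> skew_classes Q" "x \<in> \<omega>" "separator (mm_minor Q {x}) X"
    and "S \<in> subtransversals Q" "\<omega> \<inter> S = {}"
  shows "rank Q (insert x S) + rank Q {x} = rank Q (insert x (S \<inter> X)) + rank Q (insert x (S - X))"
  using assms(3-5) unfolding separator_minor_iff[OF assms(1,2)] by simp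

lemma minor_separator_disjoint:
  assumes "\<omega> \<in> skew_classes Q" "x \<in> \<omega>" "separator (mm_minor Q {x}) X"
  shows "\<omega> \<inter> X = {}"
proof -
  obtain F where "F \<subseteq> skew_classes Q - {\<omega>}" "X = \<Union>F" using minor_separator_classes[OF assms] .
  then show ?thesis using class_inter_Union[OF assms(1), of F] by blast
qed

lemma minor_proper_separator_complement:
  assumes w: "\<omega> \<in> skew_classes Q" "x \<in> \<omega>" and sep: "proper_separator (mm_minor Q {x}) X"
  shows "proper_separator (mm_minor Q {x}) (ground Q - \<omega> - X)"
proof -
  have sX: "separator (mm_minor Q {x}) X" and X: "X \<noteq> {}" "X \<noteq> ground Q - \<omega>"
    using sep unfolding proper_separator_def minor_singleton_ground[OF w] by blast+
  obtain F where F: "F \<subseteq> skew_classes Q - {\<omega>}" "X = \<Union>F"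
    using minor_separator_classes[OF w sX] .
  have U: "\<Union>(skew_classes Q - {\<omega>}) = ground Q - \<omega>"
    using minor_ground minor_singleton_classes[OF w] minor_singleton_ground[OF w] by metis
  have disj: "\<phi> \<inter> X = {}" if "\<phi> \<in> skew_classes Q - {\<omega>} - F" for \<phi>
    using class_inter_Union[of \<phi> F] that F by blast
  have "ground Q - \<omega> - X = \<Union>(skew_classes Q - {\<omega>} - F)"
  proof (intro equalityI subsetI)
    fix y assume "y \<in> ground Q - \<omega> - X"
    then show "y \<in> \<Union>(skew_classes Q - {\<omega>} - F)" unfolding U[symmetric] F(2) by blast
  next
    fix y assume "y \<in> \<Union>(skew_classes Q - {\<omega>} - F)"
    then obtain \<phi> where p: "\<phi> \<in> skew_classes Q - {\<omega>} - F" "y \<in> \<phi>" by blast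
    then show "y \<in> ground Q - \<omega> - X" unfolding U[symmetric] using disj[OF p(1)] by blast
  qed
  then have cl: "\<exists>G\<subseteq>skew_classes Q - {\<omega>}. ground Q - \<omega> - X = \<Union>G"
    by (intro exI[of _ "skew_classes Q - {\<omega>} - F"]) simp
  have "rank Q (insert x S) + rank Q {x} = rank Q (insert x (S \<inter> (ground Q - \<omega> - X)))
      + rank Q (insert x (S - (ground Q - \<omega> - X)))"
    if S: "S \<in> subtransversals Q" "\<omega> \<inter> S = {}" for S
  proof -
    have "S \<inter> (ground Q - \<omega> - X) = S - X" "S - (ground Q - \<omega> - X) = S \<inter> X"
      using subtransversal_ground[OF S(1)] S(2) by blast+
    then show ?thesis using minor_separator_rank[OF w sX S] by simp
  qed
  then have "separator (mm_minor Q {x}) (ground Q - \<omega> - X)"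
    unfolding separator_minor_iff[OF w] using cl by simp
  moreover have "X \<subseteq> ground Q - \<omega>" unfolding U[symmetric] F(2) using F(1) by blast
  ultimately show ?thesis
    using X unfolding proper_separator_def minor_singleton_ground[OF w] by blast
qed

text \<open>A proper separator of \<open>Q|x\<close> forces a class other than
  \<open>\<omega>\<close>, so \<open>\<omega>\<close> is not the whole ground set.\<close>

lemma proper_separator_rank_singleton:
  assumes "mm_connected Q" and w: "\<omega> \<in> skew_classes Q" "x \<in> \<omega>"
    and sep: "proper_separator (mm_minor Q {x}) X"
  shows "rank Q {x} = 1"
proof -
  have "ground Q - \<omega> \<noteq> {}"
    using sep minor_proper_separator_complement[OF w sep] unfolding proper_separator_def by blast
  then show ?thesis using connected_rank_singleton[OF assms(1) w(1) _ w(2)] by blast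
qed

section \<open>Spanning \<open>e\<close> from one side of a separator of \<open>Q|e\<close>\<close>

text \<open>By contradiction: if nothing inside \<open>X\<close> spans \<open>e\<close>, then
  \<open>X\<close> is a proper separator of \<open>Q\<close> itself.\<close>

lemma separator_spans:
  assumes conn: "mm_connected Q" and tight: "tight Q"
    and w: "\<omega> \<in> skew_classes Q" "e \<in> \<omega>"
    and sep: "proper_separator (mm_minor Q {e}) X"
  obtains S where "S \<in> subtransversals Q" "S \<subseteq> X" "spans Q S e"
proof (rule ccontr)
  note result = that
  assume "\<not> thesis"
  then have no: "\<not> spans Q S e" if "S \<in> subtransversals Q" "S \<subseteq> X" for S
    using result[OF that] by blast
  have sep': "separator (mm_minor Q {e}) X" using sep unfolding proper_separator_def by blast
  obtain F where F: "F \<subseteq> skew_classes Q - {\<omega>}" "X = \<Union>F"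
    using minor_separator_classes[OF w sep'] .
  note sepr = minor_separator_rank[OF w sep']
  have wX: "\<omega> \<inter> X = {}" using minor_separator_disjoint[OF w sep'] .
  have "X \<noteq> {}" using sep unfolding proper_separator_def by blast
  have re: "rank Q {e} = 1" using proper_separator_rank_singleton[OF conn w sep] .
  have st: "S \<inter> X \<in> subtransversals Q" "S - X \<in> subtransversals Q" if "S \<in> subtransversals Q" for S
    using subtransversal_subset[OF that] by blast+
  \<comment> \<open>For \<open>S\<close> avoiding \<open>\<omega>\<close>, the part in
    \<open>X\<close> gains 1 from \<open>e\<close> by assumption. Cancelling this gain against
    \<open>r(e) = 1\<close> in the separator identity of \<open>Q|e\<close> gives the rank splitting
    for \<open>Q\<close>.\<close>
  have split: "rank Q S = rank Q (S \<inter> X) + rank Q (S - X) \<and> (spans Q S e \<longrightarrow> spans Q (S - X) e)"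
    if S: "S \<in> subtransversals Q" "\<omega> \<inter> S = {}" for S
  proof -
    have X: "rank Q (insert e (S \<inter> X)) = rank Q (S \<inter> X) + 1"
      using rank_not_spans[OF st(1)[OF S(1)] w] no st(1)[OF S(1)] S(2) by blast
    have "(S \<inter> X) \<union> (S - X) = S" "(S \<inter> X) \<inter> (S - X) = {}" by blast+
    then have sub: "rank Q S \<le> rank Q (S \<inter> X) + rank Q (S - X)"
      using rank_submodular[OF st[OF S(1)]] S(1) rank_empty by simp
    have up: "rank Q (insert e S) \<le> rank Q S + 1" using rank_insert[OF S(1) w S(2)] by blast
    show ?thesis
    proof (cases "spans Q (S - X) e")
      case True
      then have "spans Q S e" using spans_mono[OF _ _ S(1) w S(2)] by blast
      then show ?thesis using True X sepr[OF S] re unfolding spans_def by linarith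
    next
      case False
      then have "rank Q (insert e (S - X)) = rank Q (S - X) + 1"
        using rank_not_spans[OF st(2)[OF S(1)] w] S(2) by blast
      then show ?thesis using X sepr[OF S] re sub up unfolding spans_def by linarith
    qed
  qed
  \<comment> \<open>The second claim of \<open>split\<close> extends from \<open>e\<close> to every
    \<open>z\<close> in \<open>\<omega>\<close>; this is where tightness enters.\<close>
  have spz: "spans Q (S - X) z"
    if S: "S \<in> subtransversals Q" "\<omega> \<inter> S = {}" and z: "z \<in> \<omega>" "spans Q S z" for S z
  proof (rule ccontr)
    assume nz: "\<not> spans Q (S - X) z"
    have S_eq: "(S - X) \<union> (S \<inter> X) = S" by blast
    have "finite (S \<inter> X)" using subtransversal_finite[OF S(1)] by blast
    moreover have "\<not> spans Q ((S - X) \<union> {}) z" using nz by simp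
    moreover have "spans Q ((S - X) \<union> (S \<inter> X)) z" using z(2) unfolding S_eq .
    ultimately have "\<exists>D a. insert a D \<subseteq> S \<inter> X \<and> a \<notin> D \<and> \<not> spans Q ((S - X) \<union> D) z
        \<and> spans Q ((S - X) \<union> insert a D) z"
      by (rule finite_first_step)
    then obtain D a where D: "insert a D \<subseteq> S \<inter> X" "a \<notin> D" "\<not> spans Q ((S - X) \<union> D) z"
      "spans Q ((S - X) \<union> insert a D) z"
      by (elim exE conjE) (rule that)
    \<comment> \<open>\<open>T0\<close> is the last set before \<open>z\<close> becomes spanned when
      elements of \<open>S \<inter> X\<close> are added to \<open>S - X\<close>; adding
      \<open>a\<close> makes it spanned.\<close>
    define T0 where "T0 = (S - X) \<union> D"
    have T0S: "T0 \<subseteq> S" "insert a T0 \<subseteq> S" using D(1) unfolding T0_def by blast+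
    have "\<omega> \<inter> T0 = {}" using T0S(1) S(2) by blast
    moreover have "a \<notin> T0" using D(1,2) unfolding T0_def by blast
    ultimately have T0: "T0 \<in> subtransversals Q" "insert a T0 \<in> subtransversals Q" "\<omega> \<inter> T0 = {}" "a \<notin> T0"
      using subtransversal_subset[OF S(1)] T0S by simp_all
    have sp: "\<not> spans Q T0 z" "spans Q (insert a T0) z" using D unfolding T0_def by simp_all
    obtain \<omega>' where w': "\<omega>' \<in> F" "a \<in> \<omega>'" using D(1) F(2) by blast
    have w'2: "\<omega>' \<in> skew_classes Q" "\<omega>' \<noteq> \<omega>" using w' F by blast+
    have T0w': "\<omega>' \<inter> T0 = {}" using class_inter_insert_eq[OF T0(2) w'2(1) w'(2) T0(4)] .
    define G where "G = skew_classes Q - {\<omega>, \<omega>'}"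
    have G: "G \<subseteq> skew_classes Q" "\<omega> \<notin> G" "\<omega>' \<notin> G" unfolding G_def by blast+
    obtain T where T: "T \<in> subtransversals Q" "T0 \<subseteq> T" "T \<subseteq> T0 \<union> \<Union>G" "\<not> spans Q T z"
      "\<forall>g\<in>G. g \<inter> T \<noteq> {}"
      \<comment> \<open>\<open>T\<close> meets all classes except \<open>\<omega>\<close> and
        \<open>\<omega>'\<close> and still does not span \<open>z\<close>, which is the situation of
        \<open>tight_exchange\<close>.\<close>
      using extend_not_spanning[OF T0(1) G(1) sp(1) w(1) z(1) T0(3) G(2)] tight
      unfolding tight_def by blast
    have wT: "\<omega> \<inter> T = {}" using T(3) T0(3) class_inter_Union[OF w(1) G(1,2)] by blast
    have w'T: "\<omega>' \<inter> T = {}" using T(3) T0w' class_inter_Union[OF w'2(1) G(1,3)] by blast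
    have ins: "insert c T \<in> subtransversals Q" "\<omega> \<inter> insert c T = {}" if "c \<in> \<omega>'" for c
      using subtransversal_insert[OF T(1) w'2(1) that w'T] wT wX that w'(1) F(2) by blast+
    have aT: "spans Q (insert a T) z"
      using spans_mono[OF sp(2) _ ins(1)[OF w'(2)] w(1) z(1) ins(2)[OF w'(2)]] T(2) by blast
    obtain c where c: "c \<in> \<omega>'" "spans Q (insert c T) e"
      using tight_exchange[OF tight T(1) w(1) wT z(1) w(2) w'2(1) w'T w'(2) w'2(2) _ aT T(4)] T(5)
      unfolding G_def by blast
    have "insert c T - X = T - X" using c(1) w'(1) F(2) by blast
    then have "spans Q (T - X) e" using split[OF ins[OF c(1)]] c(2) by simp
    then have eT: "spans Q T e" using spans_mono[OF _ _ T(1) w wT] by blast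
    then have "spans Q (insert a T) e"
      using spans_mono[OF _ _ ins(1)[OF w'(2)] w ins(2)[OF w'(2)]] by blast
    then have "z = e" using spans_unique[OF ins(1)[OF w'(2)] w(1) ins(2)[OF w'(2)] z(1) w(2) aT] by blast
    then show False using eT T(4) by blast
  qed
  have "rank Q S = rank Q (S \<inter> X) + rank Q (S - X)" if S: "S \<in> subtransversals Q" for S
  proof (cases "\<omega> \<inter> S = {}")
    case True
    then show ?thesis using split[OF S] by blast
  next
    case False
    then obtain z where z: "z \<in> S" "z \<in> \<omega>" by blast
    define S' where "S' = S - {z}"
    have S': "S = insert z S'" "S' \<in> subtransversals Q" "z \<notin> S'"
      using z subtransversal_subset[OF S] unfolding S'_def by blast+
    have wS': "\<omega> \<inter> S' = {}" using class_inter_insert_eq[OF _ w(1) z(2) S'(3)] S S'(1) by simp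
    \<comment> \<open>The element \<open>z\<close> of \<open>\<omega>\<close> falls on the side of
      \<open>S - X\<close>. By \<open>spz\<close> and monotonicity it has the same increment over
      \<open>S'\<close> as over \<open>S' - X\<close>.\<close>
    have SX: "S \<inter> X = S' \<inter> X" "S - X = insert z (S' - X)" using S'(1) wX z(2) by blast+
    show ?thesis
    proof (cases "spans Q S' z")
      case True
      then show ?thesis using spz[OF S'(2) wS' z(2)] split[OF S'(2) wS'] SX S'(1)
        unfolding spans_def by simp
    next
      case False
      then have "\<not> spans Q (S' - X) z" using spans_mono[OF _ _ S'(2) w(1) z(2) wS'] by blast
      then have "rank Q (insert z (S' - X)) = rank Q (S' - X) + 1"
        using rank_not_spans[OF st(2)[OF S'(2)] w(1) z(2)] wS' by blast
      moreover have "rank Q S = rank Q S' + 1"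
        using rank_not_spans[OF S'(2) w(1) z(2) wS' False] S'(1) by simp
      ultimately show ?thesis using split[OF S'(2) wS'] SX by simp
    qed
  qed
  then have "separator Q X" unfolding separator_def using F by blast
  moreover have "X \<noteq> ground Q" using wX w class_subset by blast
  ultimately show False
    using conn \<open>X \<noteq> {}\<close> unfolding mm_connected_def proper_separator_def by blast
qed

section \<open>Comparing \<open>Q|e\<close> with \<open>Q|x\<close>\<close>

text \<open>\<open>W \<union> Z\<close> spans \<open>e\<close>, hence not \<open>x\<close>, so
  adding \<open>x\<close> costs 1 more than adding \<open>e\<close>. This 1 is the
  \<open>r(e)\<close> in the separator identity of \<open>Q|e\<close>.\<close>

lemma rank_separated_exchange:
  assumes w: "\<omega> \<in> skew_classes Q" "e \<in> \<omega>" "x \<in> \<omega>" "x \<noteq> e"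
    and sep: "separator (mm_minor Q {e}) X" and re: "rank Q {e} = 1"
    and W: "W \<in> subtransversals Q" "W \<subseteq> X"
    and Z: "Z \<in> subtransversals Q" "Z \<inter> X = {}" "\<omega> \<inter> Z = {}" "spans Q Z e"
  shows "rank Q (insert x (W \<union> Z)) = rank Q (insert e W) + rank Q Z"
proof -
  obtain F where F: "F \<subseteq> skew_classes Q - {\<omega>}" "X = \<Union>F"
    using minor_separator_classes[OF w(1,2) sep] .
  note sepr = minor_separator_rank[OF w(1,2) sep]
  have wX: "\<omega> \<inter> X = {}" using minor_separator_disjoint[OF w(1,2) sep] .
  have "W \<union> Z \<in> subtransversals Q"
    using subtransversal_Un_separated[OF _ W(1) _ Z(1)] F W(2) Z(2) by blast
  moreover have wWZ: "\<omega> \<inter> (W \<union> Z) = {}" using W(2) Z(3) wX by blast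
  ultimately have WZ: "W \<union> Z \<in> subtransversals Q" "\<omega> \<inter> (W \<union> Z) = {}" by blast+
  have sp: "spans Q (W \<union> Z) e" using spans_mono[OF Z(4) _ WZ(1) w(1,2) WZ(2)] by blast
  then have "\<not> spans Q (W \<union> Z) x" using spans_unique[OF WZ(1) w(1) WZ(2) w(3,2)] w(4) by blast
  then have "rank Q (insert x (W \<union> Z)) = rank Q (insert e (W \<union> Z)) + 1"
    using rank_not_spans[OF WZ(1) w(1,3) WZ(2)] sp unfolding spans_def by simp
  moreover have "(W \<union> Z) \<inter> X = W" "(W \<union> Z) - X = Z" using W(2) Z(2) by blast+
  ultimately show ?thesis using sepr[OF WZ] re Z(4) unfolding spans_def by simp
qed

text \<open>On subsets of \<open>X\<close>, contracting \<open>Z \<union> x\<close> acts like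
  contracting \<open>e\<close>, so the splitting along \<open>P\<close> carries over from
  \<open>Q|x\<close> to \<open>Q|e\<close>.\<close>

lemma separator_transfer:
  assumes w: "\<omega> \<in> skew_classes Q" "e \<in> \<omega>" "x \<in> \<omega>" "x \<noteq> e"
    and sep: "separator (mm_minor Q {e}) X" and re: "rank Q {e} = 1"
    and W: "W \<in> subtransversals Q" "W \<subseteq> X"
    and Z: "Z \<in> subtransversals Q" "Z \<inter> X = {}" "\<omega> \<inter> Z = {}" "spans Q Z e"
    and P: "separator (mm_minor Q {x}) P"
  shows "rank Q (insert e W) + 1 = rank Q (insert e (W \<inter> P)) + rank Q (insert e (W - P))"
proof -
  obtain F where F: "F \<subseteq> skew_classes Q - {\<omega>}" "X = \<Union>F"
    using minor_separator_classes[OF w(1,2) sep] .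
  have wX: "\<omega> \<inter> X = {}" using minor_separator_disjoint[OF w(1,2) sep] .
  have eq: "rank Q (insert e V) + rank Q Z + rank Q {x}
      = rank Q (insert x ((V \<union> Z) \<inter> P)) + rank Q (insert x ((V \<union> Z) - P))"
    if V: "V \<subseteq> W" for V
  proof -
    have V': "V \<in> subtransversals Q" "V \<subseteq> X" using subtransversal_subset[OF W(1) V] W(2) V by blast+
    have "V \<union> Z \<in> subtransversals Q"
      using subtransversal_Un_separated[OF _ V'(1) _ Z(1)] F V'(2) Z(2) by blast
    moreover have "\<omega> \<inter> (V \<union> Z) = {}" using V'(2) Z(3) wX by blast
    ultimately show ?thesis
      using minor_separator_rank[OF w(1,3) P] rank_separated_exchange[OF w sep re V' Z] by metis
  qed
  \<comment> \<open>The instances of \<open>eq\<close> for \<open>W\<close> and for the empty set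
    have together the same right-hand terms as those for \<open>W \<inter> P\<close> and
    \<open>W - P\<close>; these and all copies of \<open>r(Z)\<close> and \<open>r(x)\<close>
    cancel.\<close>
  have sets: "((W \<inter> P) \<union> Z) \<inter> P = (W \<union> Z) \<inter> P" "((W \<inter> P) \<union> Z) - P = Z - P"
    "((W - P) \<union> Z) \<inter> P = Z \<inter> P" "((W - P) \<union> Z) - P = (W \<union> Z) - P" by blast+
  show ?thesis
    using eq[of W] eq[of "W \<inter> P"] eq[of "W - P"] eq[of "{}"] re unfolding sets by simp
qed

lemma connected_minor_other:
  assumes conn: "mm_connected Q" and tight: "tight Q"
    and w: "\<omega> \<in> skew_classes Q" "e \<in> \<omega>" "x \<in> \<omega>" "x \<noteq> e"
    and sep: "proper_separator (mm_minor Q {e}) X"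
  shows "mm_connected (mm_minor Q {x})"
proof (rule ccontr)
  assume "\<not> mm_connected (mm_minor Q {x})"
  then obtain P where P: "proper_separator (mm_minor Q {x}) P" unfolding mm_connected_def by blast
  have sX: "separator (mm_minor Q {e}) X" and sP: "separator (mm_minor Q {x}) P"
    using sep P unfolding proper_separator_def by blast+
  define Y where "Y = ground Q - \<omega> - X"
  have Y: "proper_separator (mm_minor Q {e}) Y"
    using minor_proper_separator_complement[OF w(1,2) sep] unfolding Y_def .
  then have sY: "separator (mm_minor Q {e}) Y" unfolding proper_separator_def by blast
  have re: "rank Q {e} = 1" using proper_separator_rank_singleton[OF conn w(1,2) sep] .
  have wX: "\<omega> \<inter> X = {}" using minor_separator_disjoint[OF w(1,2) sX] .
  have wY: "\<omega> \<inter> Y = {}" unfolding Y_def by blast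
  have wP: "\<omega> \<inter> P = {}" using minor_separator_disjoint[OF w(1,3) sP] .
  obtain SX where SX: "SX \<in> subtransversals Q" "SX \<subseteq> X" "spans Q SX e"
    using separator_spans[OF conn tight w(1,2) sep] .
  obtain SY where SY: "SY \<in> subtransversals Q" "SY \<subseteq> Y" "spans Q SY e"
    using separator_spans[OF conn tight w(1,2) Y] .
  have disj: "SX \<inter> Y = {}" "SY \<inter> X = {}" "\<omega> \<inter> SX = {}" "\<omega> \<inter> SY = {}"
    using SX(2) SY(2) wX wY unfolding Y_def by blast+
  \<comment> \<open>\<open>P\<close> separates \<open>Q|e\<close>: transfer the splitting to the
    \<open>X\<close> part by means of \<open>SY\<close> and to the \<open>Y\<close> part by means of
    \<open>SX\<close>, then reassemble along \<open>X\<close>.\<close>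
  have "rank Q (insert e S) + rank Q {e} = rank Q (insert e (S \<inter> P)) + rank Q (insert e (S - P))"
    if S: "S \<in> subtransversals Q" "\<omega> \<inter> S = {}" for S
  proof -
    have st: "V \<in> subtransversals Q" "\<omega> \<inter> V = {}" if "V \<subseteq> S" for V
      using subtransversal_subset[OF S(1) that] S(2) that by blast+
    have SY: "S - X \<subseteq> Y" using subtransversal_ground[OF S(1)] S(2) unfolding Y_def by blast
    have 1: "rank Q (insert e (S \<inter> X)) + 1
        = rank Q (insert e (S \<inter> X \<inter> P)) + rank Q (insert e (S \<inter> X - P))"
      by (rule separator_transfer[OF w sX re st(1) _ \<open>SY \<in> _\<close> disj(2,4) \<open>spans Q SY e\<close> sP]) blast+
    have 2: "rank Q (insert e (S - X)) + 1
        = rank Q (insert e ((S - X) \<inter> P)) + rank Q (insert e (S - X - P))"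
      by (rule separator_transfer[OF w sY re st(1) SY SX(1) disj(1,3) SX(3) sP]) blast
    have sets: "S \<inter> P \<inter> X = S \<inter> X \<inter> P" "S \<inter> P - X = (S - X) \<inter> P" "(S - P) \<inter> X = S \<inter> X - P"
      "S - P - X = S - X - P" by blast+
    have r: "rank Q (insert e V) + 1 = rank Q (insert e (V \<inter> X)) + rank Q (insert e (V - X))"
      if "V \<subseteq> S" for V
      using minor_separator_rank[OF w(1,2) sX st[OF that]] re by simp
    show ?thesis
      using r[of S] r[of "S \<inter> P"] r[of "S - P"] 1 2 re unfolding sets by force
  qed
  moreover have "\<exists>F\<subseteq>skew_classes Q - {\<omega>}. P = \<Union>F"
    using minor_separator_classes[OF w(1,3) sP] by metis
  ultimately have "separator (mm_minor Q {e}) P" unfolding separator_minor_iff[OF w(1,2)] by blast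
  then have Pe: "proper_separator (mm_minor Q {e}) P"
    using P unfolding proper_separator_def minor_singleton_ground[OF w(1,2)]
      minor_singleton_ground[OF w(1,3)] by blast
  \<comment> \<open>\<open>P\<close> is now proper for both minors, so
    \<open>separator_spans\<close> yields a set in \<open>P\<close> spanning \<open>e\<close> and
    one outside \<open>P\<close> spanning \<open>x\<close>. Their union would span a skew
    pair.\<close>
  obtain S1 where S1: "S1 \<in> subtransversals Q" "S1 \<subseteq> P" "spans Q S1 e"
    using separator_spans[OF conn tight w(1,2) Pe] .
  obtain S2 where S2: "S2 \<in> subtransversals Q" "S2 \<subseteq> ground Q - \<omega> - P" "spans Q S2 x"
    using separator_spans[OF conn tight w(1,3) minor_proper_separator_complement[OF w(1,3) P]] .
  obtain F where F: "F \<subseteq> skew_classes Q - {\<omega>}" "P = \<Union>F"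
    using minor_separator_classes[OF w(1,3) sP] .
  have un: "S1 \<union> S2 \<in> subtransversals Q"
  proof (rule subtransversal_Un_separated[OF _ S1(1) _ S2(1)])
    show "F \<subseteq> skew_classes Q" using F(1) by blast
    show "S1 \<subseteq> \<Union>F" "S2 \<inter> \<Union>F = {}" using S1(2) S2(2) unfolding F(2)[symmetric] by blast+
  qed
  have wS: "\<omega> \<inter> (S1 \<union> S2) = {}" using S1(2) S2(2) wP by blast
  have "spans Q (S1 \<union> S2) e" "spans Q (S1 \<union> S2) x"
    using spans_mono[OF S1(3) _ un w(1,2) wS] spans_mono[OF S2(3) _ un w(1,3) wS] by simp_all
  then have "x = e" using spans_unique[OF un w(1) wS w(3,2)] by blast
  then show False using w(4) by blast
qed

section \<open>Passing from \<open>Q|e\<close> to \<open>Q|A\<close>\<close>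

lemma rank_minor_split:
  assumes w: "\<omega> \<in> skew_classes Q" "e \<in> \<omega>" and sep: "separator (mm_minor Q {e}) X"
    and V: "V \<in> subtransversals Q" "e \<in> V"
  shows "rank Q V + rank Q {e} = rank Q (insert e (V \<inter> X)) + rank Q (insert e (V - X))"
proof -
  have ins: "insert e (V - {e}) = V" using V(2) by blast
  have wV: "\<omega> \<inter> (V - {e}) = {}" using class_inter_insert_eq[OF _ w, of "V - {e}"] V(1) ins by simp
  have V': "V - {e} \<in> subtransversals Q" using subtransversal_subset[OF V(1)] by blast
  have "e \<notin> X" using minor_separator_disjoint[OF w sep] w(2) by blast
  then have "(V - {e}) \<inter> X = V \<inter> X" "insert e (V - {e} - X) = insert e (V - X)" by blast+
  then show ?thesis using minor_separator_rank[OF w sep V' wV] ins by simp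
qed

lemma separator_minor:
  assumes w: "\<omega> \<in> skew_classes Q" "e \<in> \<omega>" and sep: "separator (mm_minor Q {e}) X"
    and A: "A \<in> subtransversals Q" "e \<in> A"
  shows "separator (mm_minor Q A) (X \<inter> ground (mm_minor Q A))"
  unfolding separator_def
proof (intro conjI ballI)
  obtain F where F: "F \<subseteq> skew_classes Q - {\<omega>}" "X = \<Union>F"
    using minor_separator_classes[OF w sep] .
  have cl: "skew_classes (mm_minor Q A) = {\<phi> \<in> skew_classes Q. \<phi> \<inter> A = {}}"
    unfolding mm_minor_def by simp
  have "X \<inter> ground (mm_minor Q A) = \<Union>{\<phi> \<in> F. \<phi> \<inter> A = {}}"
  proof (intro equalityI subsetI)
    fix y assume "y \<in> X \<inter> ground (mm_minor Q A)"
    then obtain \<phi> \<psi> where y: "\<phi> \<in> F" "y \<in> \<phi>" "\<psi> \<in> skew_classes Q" "\<psi> \<inter> A = {}" "y \<in> \<psi>"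
      unfolding minor_ground cl F(2) by blast
    then have "\<phi> = \<psi>" using class_unique[of \<phi> \<psi> y] F(1) by blast
    then show "y \<in> \<Union>{\<phi> \<in> F. \<phi> \<inter> A = {}}" using y by blast
  next
    fix y assume "y \<in> \<Union>{\<phi> \<in> F. \<phi> \<inter> A = {}}"
    then show "y \<in> X \<inter> ground (mm_minor Q A)" unfolding minor_ground cl F(2) using F(1) by blast
  qed
  moreover have "{\<phi> \<in> F. \<phi> \<inter> A = {}} \<subseteq> skew_classes (mm_minor Q A)" unfolding cl using F(1) by blast
  ultimately show "\<exists>F\<subseteq>skew_classes (mm_minor Q A). X \<inter> ground (mm_minor Q A) = \<Union>F" by metis
next
  fix S assume "S \<in> subtransversals (mm_minor Q A)"
  then have S: "S \<union> A \<in> subtransversals Q" "S \<subseteq> ground (mm_minor Q A)"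
    unfolding minor_subtransversal_iff[OF A(1)] by blast+
  have st: "V \<union> A \<in> subtransversals Q" if "V \<subseteq> S" for V
    using subtransversal_subset[OF S(1)] that by (meson Un_mono order_refl)
  have r: "rank Q (V \<union> A) + rank Q {e}
      = rank Q (insert e ((V \<union> A) \<inter> X)) + rank Q (insert e (V \<union> A - X))" if "V \<subseteq> S" for V
    using rank_minor_split[OF w sep st[OF that]] A(2) by simp
  have le: "rank Q A \<le> rank Q (V \<union> A)" if "V \<subseteq> S" for V
    using rank_mono[OF st[OF that]] by simp
  have sets: "((S \<inter> X) \<union> A) \<inter> X = (S \<union> A) \<inter> X" "(S \<inter> X) \<union> A - X = A - X"
    "((S - X) \<union> A) \<inter> X = A \<inter> X" "(S - X) \<union> A - X = S \<union> A - X" by blast+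
  \<comment> \<open>Four instances of \<open>r\<close> are combined; the terms on the right-hand
    sides occur in equal pairs by \<open>sets\<close>.\<close>
  have "rank Q (S \<union> A) + rank Q A = rank Q ((S \<inter> X) \<union> A) + rank Q ((S - X) \<union> A)"
    using r[of S] r[of "S \<inter> X"] r[of "S - X"] r[of "{}"] unfolding sets by simp
  moreover have "S \<inter> (X \<inter> ground (mm_minor Q A)) = S \<inter> X" "S - X \<inter> ground (mm_minor Q A) = S - X"
    using S(2) by blast+
  moreover have "rank (mm_minor Q A) V = rank Q (V \<union> A) - rank Q A" for V
    unfolding mm_minor_def by simp
  ultimately show "rank (mm_minor Q A) S = rank (mm_minor Q A) (S \<inter> (X \<inter> ground (mm_minor Q A)))
      + rank (mm_minor Q A) (S - X \<inter> ground (mm_minor Q A))"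
    using le[of S] le[of "S \<inter> X"] le[of "S - X"] by simp
qed

text \<open>\<open>Q|A\<close> lives inside \<open>X\<close>, where the contraction of
  \<open>e\<close> can be replaced by that of \<open>x\<close> together with a set outside
  \<open>X\<close> spanning \<open>e\<close>.\<close>

lemma has_minor_other:
  assumes w: "\<omega> \<in> skew_classes Q" "e \<in> \<omega>" "x \<in> \<omega>" "x \<noteq> e"
    and sep: "separator (mm_minor Q {e}) X" and re: "rank Q {e} = 1"
    and A: "A \<in> subtransversals Q" "e \<in> A" "ground (mm_minor Q A) \<subseteq> X"
    and Z: "Z \<in> subtransversals Q" "Z \<inter> X = {}" "\<omega> \<inter> Z = {}" "spans Q Z e"
  shows "has_minor (mm_minor Q {x}) (mm_minor Q A)"
proof -
  obtain F where F: "F \<subseteq> skew_classes Q - {\<omega>}" "X = \<Union>F"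
    using minor_separator_classes[OF w(1,2) sep] .
  have wX: "\<omega> \<inter> X = {}" using minor_separator_disjoint[OF w(1,2) sep] .
  define G where "G = skew_classes Q - {\<omega>} - F"
  have G: "G \<subseteq> skew_classes Q" "\<omega> \<notin> G" unfolding G_def by blast+
  have GX: "\<Union>G \<inter> X = {}"
  proof -
    have "g \<inter> X = {}" if "g \<in> G" for g
      using class_inter_Union[of g F] that F unfolding G_def by blast
    then show ?thesis by blast
  qed
  \<comment> \<open>\<open>Z\<close> is enlarged to meet every class outside \<open>X\<close> other
    than \<open>\<omega>\<close>, so that contracting it removes all of these classes.\<close>
  obtain Z' where Z': "Z' \<in> subtransversals Q" "Z' \<subseteq> Z \<union> \<Union>G" "spans Q Z' e"
    "\<forall>g\<in>G. g \<inter> Z' \<noteq> {}"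
    using extend_spanning[OF Z(1) G(1) Z(4) w(1,2) Z(3) G(2)] by metis
  have Z'X: "Z' \<inter> X = {}" using Z'(2) Z(2) GX by blast
  have Z'w: "\<omega> \<inter> Z' = {}" using Z'(2) Z(3) class_inter_Union[OF w(1) G] by blast
  define B where "B = (A \<inter> X) \<union> Z'"
  have AX: "A \<inter> X \<in> subtransversals Q" using subtransversal_subset[OF A(1)] by blast
  have B: "B \<in> subtransversals Q" "\<omega> \<inter> B = {}"
  proof -
    show "B \<in> subtransversals Q"
      unfolding B_def
    proof (rule subtransversal_Un_separated[OF _ AX _ Z'(1)])
      show "F \<subseteq> skew_classes Q" using F(1) by blast
      show "A \<inter> X \<subseteq> \<Union>F" "Z' \<inter> \<Union>F = {}" using Z'X unfolding F(2)[symmetric] by blast+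
    qed
    show "\<omega> \<inter> B = {}" unfolding B_def using wX Z'w by blast
  qed
  then have Bx: "B \<in> subtransversals (mm_minor Q {x})"
    using minor_singleton_subtransversal_iff[OF w(1,3)] by blast
  have cl: "skew_classes (mm_minor Q A) = {\<phi> \<in> skew_classes Q. \<phi> \<inter> A = {}}"
    unfolding mm_minor_def by simp
  have clB: "skew_classes (mm_minor (mm_minor Q {x}) B) = {\<phi> \<in> skew_classes Q - {\<omega>}. \<phi> \<inter> B = {}}"
    unfolding minor_singleton_classes[OF w(1,3), symmetric] by (subst mm_minor_def) simp
  have classes: "skew_classes (mm_minor Q A) = skew_classes (mm_minor (mm_minor Q {x}) B)"
    unfolding cl clB
  proof (intro Collect_cong iffI conjI)
    fix \<phi> assume p: "\<phi> \<in> skew_classes Q \<and> \<phi> \<inter> A = {}"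
    then have pX: "\<phi> \<subseteq> X" using A(3) unfolding minor_ground cl by blast
    show "\<phi> \<in> skew_classes Q - {\<omega>}" using p w(2) A(2) by blast
    show "\<phi> \<inter> B = {}" using p pX Z'X unfolding B_def by blast
  next
    fix \<phi> assume p: "\<phi> \<in> skew_classes Q - {\<omega>} \<and> \<phi> \<inter> B = {}"
    then have "\<phi> \<notin> G" using Z'(4) unfolding B_def by blast
    then have "\<phi> \<subseteq> X" using p F(2) unfolding G_def by blast
    then show "\<phi> \<in> skew_classes Q" "\<phi> \<inter> A = {}" using p unfolding B_def by blast+
  qed
  have ground: "ground (mm_minor Q A) = ground (mm_minor (mm_minor Q {x}) B)"
    unfolding minor_ground classes by (simp add: mm_minor_def)
  have "rank (mm_minor Q A) S = rank (mm_minor (mm_minor Q {x}) B) S"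
    if S: "S \<in> subtransversals (mm_minor Q A)" for S
  proof -
    have S': "S \<union> A \<in> subtransversals Q" "S \<subseteq> X"
      using S A(3) unfolding minor_subtransversal_iff[OF A(1)] by blast+
    have W: "S \<union> (A \<inter> X) \<in> subtransversals Q" "S \<union> (A \<inter> X) \<subseteq> X"
      by (rule subtransversal_subset[OF S'(1)]) (use S'(2) in blast)+
    have sets: "(S \<union> A) \<inter> X = S \<union> (A \<inter> X)" "S \<union> A - X = A - X" using S'(2) by blast+
    \<comment> \<open>In facts 1 and 2 the contribution of \<open>A - X\<close> is common, in facts
      3 and 4 that of \<open>Z'\<close>. Both differences therefore equal the increment from
      \<open>(A \<inter> X) \<union> e\<close> to
      \<open>S \<union> (A \<inter> X) \<union> e\<close>; facts 5 and 6 keep the subtractions from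
      truncating.\<close>
    have 1: "rank Q (S \<union> A) + 1 = rank Q (insert e (S \<union> (A \<inter> X))) + rank Q (insert e (A - X))"
      using rank_minor_split[OF w(1,2) sep S'(1)] A(2) re unfolding sets by simp
    have 2: "rank Q A + 1 = rank Q (insert e (A \<inter> X)) + rank Q (insert e (A - X))"
      using rank_minor_split[OF w(1,2) sep A(1,2)] re by simp
    have 3: "rank Q (insert x (S \<union> B)) = rank Q (insert e (S \<union> (A \<inter> X))) + rank Q Z'"
      using rank_separated_exchange[OF w sep re W Z'(1) Z'X Z'w Z'(3)] unfolding B_def by (simp add: Un_assoc)
    have 4: "rank Q (insert x B) = rank Q (insert e (A \<inter> X)) + rank Q Z'"
      using rank_separated_exchange[OF w sep re AX _ Z'(1) Z'X Z'w Z'(3)] unfolding B_def by simp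
    have xB: "insert x B \<in> subtransversals Q" using subtransversal_insert[OF B(1) w(1,3) B(2)] .
    have 5: "rank Q {x} \<le> rank Q (insert x B)" using rank_mono[OF xB] by simp
    have 6: "rank Q (insert e (A \<inter> X)) \<le> rank Q (insert e (S \<union> (A \<inter> X)))"
    proof (rule rank_mono)
      show "insert e (S \<union> (A \<inter> X)) \<in> subtransversals Q"
        by (rule subtransversal_subset[OF S'(1)]) (use A(2) in blast)
    qed blast
    have "rank (mm_minor (mm_minor Q {x}) B) S
        = (rank Q (insert x (S \<union> B)) - rank Q {x}) - (rank Q (insert x B) - rank Q {x})"
      unfolding mm_minor_def by simp
    moreover have "rank (mm_minor Q A) S = rank Q (S \<union> A) - rank Q A"
      unfolding mm_minor_def by simp
    ultimately show ?thesis using 1 2 3 4 5 6 by linarith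
  qed
  then show ?thesis unfolding has_minor_def same_multimatroid_def using Bx classes ground by blast
qed

end

section \<open>Choosing the side of the separator that carries \<open>Q|A\<close>\<close>

theorem theorem6:
  fixes Q :: "'a premultimatroid" and A :: "'a set" and e :: 'a
  assumes "multimatroid Q"
    and "mm_connected Q"
    and "tight Q"
    and "A \<in> subtransversals Q"
    and "A \<noteq> {}"
    and "mm_connected (mm_minor Q A)"
    and "e \<in> A"
  shows "mm_connected (mm_minor Q {e}) \<or>
    (\<forall>x. skew_pair Q e x \<longrightarrow>
       mm_connected (mm_minor Q {x}) \<and> has_minor (mm_minor Q {x}) (mm_minor Q A))"
proof (intro disj_imp[THEN iffD2] impI allI)
  fix x
  assume "\<not> mm_connected (mm_minor Q {e})" and x: "skew_pair Q e x"
  then obtain X where X: "proper_separator (mm_minor Q {e}) X" unfolding mm_connected_def by blast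
  interpret multimatroid Q by fact
  obtain \<omega> where w: "\<omega> \<in> skew_classes Q" "e \<in> \<omega>" "x \<in> \<omega>" "x \<noteq> e"
    using x unfolding skew_pair_def by blast
  define Y where "Y = ground Q - \<omega> - X"
  have Y: "proper_separator (mm_minor Q {e}) Y"
    using minor_proper_separator_complement[OF w(1,2) X] unfolding Y_def .
  have sep: "separator (mm_minor Q {e}) X" "separator (mm_minor Q {e}) Y"
    using X Y unfolding proper_separator_def by blast+
  have re: "rank Q {e} = 1" using proper_separator_rank_singleton[OF assms(2) w(1,2) X] .
  have wX: "\<omega> \<inter> X = {}" using minor_separator_disjoint[OF w(1,2) sep(1)] .
  have "ground (mm_minor Q A) \<subseteq> ground Q - \<omega>"
    unfolding mm_minor_def using class_unique[OF _ w(1)] class_subset w(2) assms(7) by auto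
  \<comment> \<open>\<open>X\<close> induces a separator of the connected \<open>Q|A\<close>, which
    must be trivial. The spanning set \<open>Z\<close> is then taken from the side opposite to
    \<open>Q|A\<close>.\<close>
  moreover have "X \<inter> ground (mm_minor Q A) = {} \<or> X \<inter> ground (mm_minor Q A) = ground (mm_minor Q A)"
    using separator_minor[OF w(1,2) sep(1) assms(4,7)] assms(6)
    unfolding mm_connected_def proper_separator_def by blast
  ultimately consider "ground (mm_minor Q A) \<subseteq> X" | "ground (mm_minor Q A) \<subseteq> Y"
    unfolding Y_def by blast
  then have "has_minor (mm_minor Q {x}) (mm_minor Q A)"
  proof cases
    case 1
    obtain Z where Z: "Z \<in> subtransversals Q" "Z \<subseteq> Y" "spans Q Z e"
      using separator_spans[OF assms(2,3) w(1,2) Y] .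
    then have "Z \<inter> X = {}" "\<omega> \<inter> Z = {}" unfolding Y_def by blast+
    then show ?thesis using has_minor_other[OF w sep(1) re assms(4,7) 1 Z(1) _ _ Z(3)] by blast
  next
    case 2
    obtain Z where Z: "Z \<in> subtransversals Q" "Z \<subseteq> X" "spans Q Z e"
      using separator_spans[OF assms(2,3) w(1,2) X] .
    then have "Z \<inter> Y = {}" "\<omega> \<inter> Z = {}" using wX unfolding Y_def by blast+
    then show ?thesis using has_minor_other[OF w sep(2) re assms(4,7) 2 Z(1) _ _ Z(3)] by blast
  qed
  then show "mm_connected (mm_minor Q {x}) \<and> has_minor (mm_minor Q {x}) (mm_minor Q A)"
    using connected_minor_other[OF assms(2,3) w X] by blast
qed

end
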